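(* Let $p(\cdot):\mathbb{R}^n\to[1,\infty)$ be a measurable radial function with $1<p_-\le p_+<\infty$. Suppose that there exist $N>1$ and $\alpha$ satisfying $$0<\alpha<\frac{p_-\min(1,p_--1)}{n}$$ such that for all $x,y\in\mathbb{R}^n$ with $|x|\ge|y|\ge N$, $$|p(x)-p(y)|\le\alpha\,\frac{1}{\log|y|}\,\log\frac{|x|}{|y|}.$$ Then $p(\cdot)$ satisfies the $\mathcal{U}_\infty$ condition.
   Context: Here $p_-:=\operatorname{ess\,inf}_{\mathbb{R}^n}p$, $p_+:=\operatorname{ess\,sup}_{\mathbb{R}^n}p$, and $p'(x):=\frac{p(x)}{p(x)-1}$. Cubes have sides parallel to the coordinate axes. For $\lambda,\tau\in(0,1)$ define on $\mathbb{R}^{2n}$ the function $$F_{p,\lambda,\tau}(x,y):=\tau^{\frac{p(y)}{p(x)-p(y)}}\lambda^{\frac{p'(x)}{p'(y)-p'(x)}}\ \text{ if } p(x)>p(y),\qquad F_{p,\lambda,\tau}(x,y):=0\ \text{ if } p(x)\le p(y).$$ $\mathcal{U}_\infty$ condition: there exist $C>0$, $r>1$ and $0<\gamma<1/2$ such that for all $0<\lambda,\tau<\gamma$ and for any finite family $\mathcal{F}$ of pairwise disjoint cubes in $\mathbb{R}^n$, $$\sum_{Q\in\mathcal{F}}\frac1{|Q|}\inf_{\substack{E\subset Q:\,|E|=\lambda|Q|\\ G\subset Q:\,|G|=\tau|Q|}}\int_{Q\setminus G}\int_{Q\setminus E}F_{p,\lambda,\tau}(x,y)^{1/r}\,dx\,dy\le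 C,$$ where the infimum is over measurable subsets $E,G$ of $Q$. *)

theory Defs
  imports "HOL-Probability.Essential_Supremum" "HOL-Library.Disjoint_Sets"
begin

definition p_minus :: "(real ^ 'n \<Rightarrow> real) \<Rightarrow> ereal" where
  "p_minus p = - esssup lebesgue (\<lambda>x. - ereal (p x))"

definition p_plus :: "(real ^ 'n \<Rightarrow> real) \<Rightarrow> ereal" where
  "p_plus p = esssup lebesgue (\<lambda>x. ereal (p x))"

definition conj_exponent :: "('a \<Rightarrow> real) \<Rightarrow> 'a \<Rightarrow> real" where
  "conj_exponent p x = p x / (p x - 1)"

definition radial :: "(real ^ 'n \<Rightarrow> real) \<Rightarrow> bool" where
  "radial p \<longleftrightarrow> (\<exists>f. \<forall>x. p x = f (norm x))"

text \<open>A cube is a product of bounded intervals of a common length \<open>h > 0\<close>. No convention on the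
  endpoints is imposed, so open, closed and half-open cubes are all included.\<close>

definition cube :: "(real ^ 'n) set \<Rightarrow> bool" where
  "cube Q \<longleftrightarrow> (\<exists>(a :: real ^ 'n) (h :: real) (I :: 'n \<Rightarrow> real set). 0 < h \<and>
     (\<forall>i. {a $ i <..< a $ i + h} \<subseteq> I i \<and> I i \<subseteq> {a $ i .. a $ i + h}) \<and>
     Q = {x. \<forall>i. x $ i \<in> I i})"

text \<open>At points with \<open>p y = 1\<close>, where the conjugate exponent is infinite, \<open>conj_exponent p y\<close> is
  the junk value 0; when \<open>1 < p_minus p\<close> these points form a null set and do not affect the
  integrals below.\<close>

definition F_fun :: "('a \<Rightarrow> real) \<Rightarrow> real \<Rightarrow> real \<Rightarrow> 'a \<Rightarrow> 'a \<Rightarrow> real" where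
  "F_fun p lam tau x y =
     (if p x > p y
      then tau powr (p y / (p x - p y)) *
           lam powr (conj_exponent p x / (conj_exponent p y - conj_exponent p x))
      else 0)"

definition subsets_of_portion :: "(real ^ 'n) set \<Rightarrow> real \<Rightarrow> (real ^ 'n) set set" where
  "subsets_of_portion Q c =
     {E \<in> sets lebesgue. E \<subseteq> Q \<and> measure lebesgue E = c * measure lebesgue Q}"

definition U_infty :: "(real ^ 'n \<Rightarrow> real) \<Rightarrow> bool" where
  "U_infty p \<longleftrightarrow>
    (\<exists>(C :: real) (r :: real) (\<gamma> :: real). 0 < C \<and> 1 < r \<and> 0 < \<gamma> \<and> \<gamma> < 1 / 2 \<and>
      (\<forall>lam tau. 0 < lam \<and> lam < \<gamma> \<and> 0 < tau \<and> tau < \<gamma> \<longrightarrow>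
        (\<forall>\<F>. finite \<F> \<and> (\<forall>Q\<in>\<F>. cube Q) \<and> disjoint \<F> \<longrightarrow>
          (\<Sum>Q\<in>\<F>. (1 / emeasure lebesgue Q) *
             (INF (E, G) \<in> subsets_of_portion Q lam \<times> subsets_of_portion Q tau.
                \<integral>\<^sup>+ y \<in> Q - G. (\<integral>\<^sup>+ x \<in> Q - E. ennreal (F_fun p lam tau x y powr (1 / r)) \<partial>lebesgue)
                  \<partial>lebesgue))
          \<le> ennreal C)))"

end

theory Submission
  imports Defs "HOL-Analysis.Ball_Volume"
begin

text \<open>For \<open>P = p_minus p\<close>, \<open>\<kappa> = P min(1, P - 1)\<close> and \<open>d = p x - p y > 0\<close> one has
  \<open>F x y \<le> (tau lam) powr (\<kappa> / d)\<close>. If \<open>m > 1\<close> and \<open>M\<close> are the smaller and the larger of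
  \<open>norm x\<close>, \<open>norm y\<close> and \<open>M / m \<le> 1 / (tau lam)\<close>, then the decay condition gives
  \<open>d \<le> \<alpha> ln (1 / (tau lam)) / ln m\<close>, so that \<open>F powr (1 / r) \<le> m powr (- s)\<close> with
  \<open>s = \<kappa> / (\<alpha> r)\<close>, and \<open>s > n\<close> for some \<open>r > 1\<close>. The ratio condition is achieved on a cube of
  side \<open>h\<close> by taking for \<open>E\<close> and \<open>G\<close> slabs of width \<open>lam h\<close> and \<open>tau h\<close> that contain the part of
  the cube near a coordinate hyperplane: outside \<open>G\<close> one has \<open>norm y \<ge> tau h / 2\<close>, hence
  \<open>M / m \<le> (2 n + 1) / tau\<close>. Thus \<open>F powr (1 / r) \<le> g x + g y\<close> with \<open>g\<close> equal to 1 near the origin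
  and to \<open>norm x powr (- s)\<close> elsewhere, and the sum over the cubes is at most \<open>2 \<integral> g\<close>.\<close>

section \<open>Cubes and slabs near a coordinate hyperplane\<close>

text \<open>Such a set differs from the closed box by part of the negligible frontier, so the
  endpoint conventions allowed by \<open>cube\<close> do not affect volumes.\<close>

lemma lebesgue_between_box_cbox:
  fixes a b :: "real ^ 'n"
  assumes le: "\<And>i. a $ i \<le> b $ i" and sub: "box a b \<subseteq> S" "S \<subseteq> cbox a b"
  shows "S \<in> lmeasurable" and "measure lebesgue S = (\<Prod>i\<in>UNIV. b $ i - a $ i)"
proof -
  have neg: "negligible (cbox a b - S)"
    using sub by (intro negligible_subset[OF negligible_frontier_interval]) auto
  have S: "S = cbox a b - (cbox a b - S)"
    using sub by auto
  show "S \<in> lmeasurable"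
    by (subst S) (intro fmeasurable.Diff lmeasurable_cbox negligible_imp_measurable neg)
  have "measure lebesgue S = measure lebesgue (cbox a b)"
    by (subst S) (rule measure_Diff_null_set, use neg in \<open>auto simp: negligible_iff_null_sets\<close>)
  also have "\<dots> = (\<Prod>i\<in>UNIV. b $ i - a $ i)"
    using le by (subst measure_completion) (auto simp: content_cbox_cart interval_ne_empty_cart)
  finally show "measure lebesgue S = (\<Prod>i\<in>UNIV. b $ i - a $ i)" .
qed

lemma cube_portion_near_origin:
  fixes Q :: "(real ^ 'n) set"
  assumes "cube Q"
  obtains h where "0 < h" "Q \<in> lmeasurable" "measure lebesgue Q = h ^ CARD('n)"
    "\<forall>x\<in>Q. \<forall>y\<in>Q. norm (x - y) \<le> real CARD('n) * h"
    "\<forall>c\<in>{0<..<1}. \<exists>E\<in>subsets_of_portion Q c. \<forall>x\<in>Q - E. c * h / 2 \<le> norm x"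
proof -
  obtain a :: "real ^ 'n" and h I where h: "0 < h"
    and I: "\<And>i. {a $ i <..< a $ i + h} \<subseteq> I i" "\<And>i. I i \<subseteq> {a $ i .. a $ i + h}"
    and Q: "Q = {x. \<forall>i. x $ i \<in> I i}"
    using assms unfolding cube_def by blast
  have I': "a $ i \<le> t" "t \<le> a $ i + h" if "t \<in> I i" for i t
    using I(2)[of i] that by auto
  let ?b = "\<chi> i. a $ i + h"
  have Q_sub: "box a ?b \<subseteq> Q" "Q \<subseteq> cbox a ?b"
    using I(1) I' by (auto simp: Q mem_box_cart dest!: subsetD intro!: subsetD[OF I(1)])
  have Q_meas: "Q \<in> lmeasurable" "measure lebesgue Q = h ^ CARD('n)"
    using lebesgue_between_box_cbox[OF _ Q_sub] h by auto
  show thesis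
  proof (rule that[OF h Q_meas]; intro ballI)
    fix x y assume xy: "x \<in> Q" "y \<in> Q"
    have "norm (x - y) \<le> (\<Sum>i\<in>UNIV. \<bar>(x - y) $ i\<bar>)"
      by (rule norm_le_l1_cart)
    also have "\<dots> \<le> (\<Sum>i\<in>(UNIV :: 'n set). h)"
    proof (rule sum_mono)
      fix i :: 'n
      show "\<bar>(x - y) $ i\<bar> \<le> h"
        using I'[of "x $ i" i] I'[of "y $ i" i] xy by (auto simp: Q abs_le_iff)
    qed
    finally show "norm (x - y) \<le> real CARD('n) * h" by simp
  next
    fix c :: real assume "c \<in> {0<..<1}"
    then have c: "0 < c" "c < 1" by auto
    obtain j :: 'n where True by simp
    \<comment> \<open>\<open>u\<close> puts the slab as close to symmetric about the hyperplane \<open>x $ j = 0\<close> as \<open>Q\<close> allows.\<close>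
    define u where "u = max (a $ j) (min (a $ j + h - c * h) (- (c * h / 2)))"
    define a' :: "real ^ 'n" where "a' = (\<chi> i. if i = j then u else a $ i)"
    define b' :: "real ^ 'n" where "b' = (\<chi> i. if i = j then u + c * h else a $ i + h)"
    define E where "E = {x \<in> Q. u \<le> x $ j \<and> x $ j \<le> u + c * h}"
    have ch: "0 < c * h" "c * h < h"
      using h c by auto
    have u: "a $ j \<le> u" "u + c * h \<le> a $ j + h"
      using ch by (auto simp: u_def)
    have "x \<in> E" if "x \<in> box a' b'" for x
    proof -
      have *: "a' $ i < x $ i" "x $ i < b' $ i" for i
        using that by (auto simp: mem_box_cart)
      have "x $ i \<in> I i" for i
        using I(1)[of i] *[of i] u
        by (cases "i = j") (auto simp: a'_def b'_def subset_iff)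
      then show ?thesis
        using *[of j] by (auto simp: E_def Q a'_def b'_def)
    qed
    moreover have "x \<in> cbox a' b'" if "x \<in> E" for x
      using that I' by (auto simp: mem_box_cart E_def Q a'_def b'_def)
    moreover have "a' $ i \<le> b' $ i" for i
      using ch h by (auto simp: a'_def b'_def)
    ultimately have E: "E \<in> lmeasurable" "measure lebesgue E = (\<Prod>i\<in>UNIV. b' $ i - a' $ i)"
      using lebesgue_between_box_cbox[of a' b' E] by auto
    have "(\<Prod>i\<in>UNIV. b' $ i - a' $ i) = (\<Prod>i\<in>UNIV. (if i = j then c else 1) * h)"
      by (rule prod.cong) (auto simp: a'_def b'_def)
    also have "\<dots> = c * h ^ CARD('n)"
      by (subst prod.distrib) simp
    finally have "E \<in> subsets_of_portion Q c"
      using E Q_meas by (auto simp: subsets_of_portion_def E_def)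
    moreover have "c * h / 2 \<le> norm x" if "x \<in> Q - E" for x
    proof -
      have "a $ j \<le> x $ j" "x $ j \<le> a $ j + h" "\<not> (u \<le> x $ j \<and> x $ j \<le> u + c * h)"
        using that I' by (auto simp: E_def Q)
      \<comment> \<open>If the slab is centred, both sides are at distance at least
        \<open>c * h / 2\<close> from the hyperplane. If it is pushed against a face, the rest of
        the cube lies on one side only, farther from the hyperplane than the slab.\<close>
      then have "c * h / 2 \<le> \<bar>x $ j\<bar>"
        using ch unfolding u_def by (auto simp: max_def min_def split: if_splits)
      then show ?thesis
        using component_le_norm_cart[of x j] by linarith
    qed
    ultimately show "\<exists>E\<in>subsets_of_portion Q c. \<forall>x\<in>Q - E. c * h / 2 \<le> norm x"
      by blast
  qed
qed

section \<open>Pointwise bounds for \<open>F_fun\<close>\<close>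

text \<open>With \<open>d = p x - p y\<close> the exponents of \<open>tau\<close> and
  \<open>lam\<close> are \<open>p y / d\<close> and \<open>p x * (p y - 1) / d\<close>. Both are at
  least \<open>P * min 1 (P - 1) / d\<close>, and powers of a base below 1 decrease in the
  exponent.\<close>

lemma F_fun_le:
  assumes P: "1 < P" "P \<le> p x" "P \<le> p y" and less: "p y < p x"
    and lt: "0 < lam" "lam < 1" "0 < tau" "tau < 1"
  shows "F_fun p lam tau x y \<le> (tau * lam) powr (P * min 1 (P - 1) / (p x - p y))"
proof -
  let ?\<kappa> = "P * min 1 (P - 1)" and ?d = "p x - p y"
  have \<kappa>: "?\<kappa> \<le> P" "?\<kappa> \<le> P * (P - 1)"
    using P by (auto simp: mult_le_cancel_left1)
  have "conj_exponent p y - conj_exponent p x = ?d / ((p x - 1) * (p y - 1))"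
    using P by (simp add: conj_exponent_def field_simps)
  then have e: "conj_exponent p x / (conj_exponent p y - conj_exponent p x)
      = p x * (p y - 1) / ?d"
    using P less by (simp add: conj_exponent_def)
  have "P * (P - 1) \<le> p x * (p y - 1)"
    using P by (intro mult_mono) auto
  then have "?\<kappa> \<le> p x * (p y - 1)" "?\<kappa> \<le> p y"
    using \<kappa> P by linarith+
  then have "?\<kappa> / ?d \<le> p x * (p y - 1) / ?d" "?\<kappa> / ?d \<le> p y / ?d"
    using less by (intro divide_right_mono; simp)+
  then have "lam powr (p x * (p y - 1) / ?d) \<le> lam powr (?\<kappa> / ?d)"
    and "tau powr (p y / ?d) \<le> tau powr (?\<kappa> / ?d)"
    using lt by (auto intro!: powr_mono')
  then have "F_fun p lam tau x y \<le> tau powr (?\<kappa> / ?d) * lam powr (?\<kappa> / ?d)"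
    using less by (auto simp: F_fun_def e intro!: mult_mono)
  then show ?thesis
    using lt by (simp add: powr_mult)
qed

lemma F_fun_nonneg: "0 \<le> F_fun p lam tau x y"
  by (simp add: F_fun_def)

lemma F_fun_le_1:
  assumes P: "1 < P" "P \<le> p x" "P \<le> p y"
    and lt: "0 < lam" "lam < 1" "0 < tau" "tau < 1"
  shows "F_fun p lam tau x y \<le> 1"
proof (cases "p y < p x")
  case True
  have "(tau * lam) powr (P * min 1 (P - 1) / (p x - p y)) \<le> 1"
    using lt P True by (intro powr_le1) (auto simp: mult_le_one)
  then show ?thesis
    using F_fun_le[of P p x y lam tau] assms True by linarith
qed (simp add: F_fun_def)

text \<open>The numbers \<open>m\<close> and \<open>M\<close> are not tied to \<open>x\<close> and
  \<open>y\<close>, so the bound serves both orders of the two norms. A one-sided \<open>osc\<close>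
  suffices because \<open>F_fun\<close> vanishes unless \<open>p y < p x\<close>.\<close>

lemma F_fun_powr_le:
  assumes P: "1 < P" "P \<le> p x" "P \<le> p y"
    and lt: "0 < lam" "lam < 1" "0 < tau" "tau < 1"
    and r: "0 < r" and \<alpha>: "0 < \<alpha>"
    and m: "1 < m" "m \<le> M" and ratio: "M / m \<le> 1 / (tau * lam)"
    and osc: "p x - p y \<le> \<alpha> * (1 / ln m) * ln (M / m)"
  shows "F_fun p lam tau x y powr (1 / r) \<le> m powr (- (P * min 1 (P - 1) / (\<alpha> * r)))"
proof (cases "p y < p x")
  case True
  let ?\<kappa> = "P * min 1 (P - 1)" and ?d = "p x - p y"
  define T where "T = ln (1 / (tau * lam))"
  have \<kappa>: "0 < ?\<kappa>" and d: "0 < ?d" and lm: "0 < ln m"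
    using P True m by auto
  have T: "T = - ln (tau * lam)"
    unfolding T_def using lt by (subst ln_div) auto
  have "ln (M / m) \<le> T"
    unfolding T_def using ratio m lt by (subst ln_le_cancel_iff) auto
  then have "\<alpha> * (1 / ln m) * ln (M / m) \<le> \<alpha> * (1 / ln m) * T"
    using \<alpha> lm by (intro mult_left_mono) auto
  then have dT: "?d \<le> \<alpha> * T / ln m"
    using osc by simp
  \<comment> \<open>The variable \<open>D\<close> keeps the difference \<open>?d\<close> as a single
    quantity while the inequality is inverted.\<close>
  have "ln m / \<alpha> \<le> T / D" if "0 < D" "D \<le> \<alpha> * T / ln m" for D
    using that lm \<alpha> by (simp add: field_simps)
  from this[OF d dT] have "?\<kappa> / r * (ln m / \<alpha>) \<le> ?\<kappa> / r * (T / ?d)"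
    using \<kappa> r by (intro mult_left_mono) auto
  then have *: "?\<kappa> / (\<alpha> * r) * ln m \<le> ?\<kappa> / ?d * (1 / r) * T"
    by (simp add: mult_ac)
  have "F_fun p lam tau x y powr (1 / r) \<le> ((tau * lam) powr (?\<kappa> / ?d)) powr (1 / r)"
    using F_fun_le[of P p x y, OF P True lt] F_fun_nonneg[of p lam tau x y] r
    by (intro powr_mono2) auto
  also have "\<dots> = exp (- (?\<kappa> / ?d * (1 / r) * T))"
    unfolding powr_powr T using lt by (simp add: powr_def)
  also have "\<dots> \<le> exp (- (?\<kappa> / (\<alpha> * r) * ln m))"
    using * by simp
  also have "\<dots> = m powr (- (?\<kappa> / (\<alpha> * r)))"
    using m by (simp add: powr_def)
  finally show ?thesis .
qed (simp add: F_fun_def)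

section \<open>Integrability of a negative power of the norm at infinity\<close>

text \<open>Dyadic shells of radii \<open>2 ^ k * N\<close> dominate the integral by a geometric
  series of ratio \<open>2 powr (n - s)\<close>, which is below 1 exactly because \<open>s\<close>
  exceeds the dimension \<open>n\<close>.\<close>

lemma nn_integral_norm_powr_outside_ball:
  fixes s N :: real
  assumes s: "real CARD('n) < s" and N: "0 < N"
  shows "(\<integral>\<^sup>+ x. ennreal (norm x powr (- s)) * indicator (- ball (0 :: real ^ 'n) N) x \<partial>lborel) < \<infinity>"
proof -
  let ?n = "CARD('n)"
  define V where "V = unit_ball_vol (real ?n)"
  define q where "q = 2 powr (real ?n - s)"
  define c where "c = V * (2 * N) ^ ?n * N powr (- s)"
  \<comment> \<open>Each shell is enlarged to the full ball of its outer radius. This costs only a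
    constant factor and gives an explicit volume.\<close>
  let ?g = "\<lambda>k x :: real ^ 'n. ennreal ((2 ^ k * N) powr (- s)) * indicator (ball 0 (2 ^ Suc k * N)) x"
  have V: "0 \<le> V" by (simp add: V_def)
  have s0: "0 < s" using s by linarith
  have term_le: "f k \<le> suminf f" for f :: "nat \<Rightarrow> ennreal" and k
    using sum_le_suminf[of f "{k}"] by simp
  have le: "ennreal (norm x powr (- s)) * indicator (- ball 0 N) x \<le> (\<Sum>k. ?g k x)"
    for x :: "real ^ 'n"
  proof (cases "norm x < N")
    case False
    \<comment> \<open>The index of the shell containing \<open>x\<close>: minimality supplies the
      inner radius, except for \<open>k = 0\<close>, where it comes from
      \<open>N \<le> norm x\<close>.\<close>
    define k where "k = (LEAST k. norm x < 2 ^ Suc k * N)"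
    obtain k0 where "norm x / N < 2 ^ k0"
      using real_arch_pow[of 2 "norm x / N"] by auto
    then have "norm x < 2 ^ k0 * N" using N by (simp add: field_simps)
    also have "\<dots> \<le> 2 ^ Suc k0 * N" using N by simp
    finally have k: "norm x < 2 ^ Suc k * N"
      unfolding k_def by (rule LeastI)
    have "2 ^ k * N \<le> norm x"
    proof (cases k)
      case 0
      then show ?thesis using False by simp
    next
      case (Suc l)
      then have "\<not> norm x < 2 ^ Suc l * N"
        using not_less_Least[of l "\<lambda>k. norm x < 2 ^ Suc k * N"] by (simp add: k_def)
      then show ?thesis by (simp add: Suc)
    qed
    then have "norm x powr (- s) \<le> (2 ^ k * N) powr (- s)"
      using N s0 by (intro powr_mono2') auto
    then have "ennreal (norm x powr (- s)) * indicator (- ball 0 N) x \<le> ?g k x"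
      using k by (auto simp: indicator_def intro: ennreal_leI)
    also have "\<dots> \<le> (\<Sum>k. ?g k x)"
      by (rule term_le)
    finally show ?thesis .
  qed (simp add: indicator_def)
  have shell: "(\<integral>\<^sup>+ x. ?g k x \<partial>lborel) = ennreal (c * q ^ k)" for k
  proof -
    have "(\<integral>\<^sup>+ x. ?g k x \<partial>lborel) =
        ennreal ((2 ^ k * N) powr (- s)) * ennreal (V * (2 ^ Suc k * N) ^ ?n)"
      using N by (simp add: nn_integral_cmult_indicator emeasure_ball V_def)
    also have "\<dots> = ennreal ((2 ^ k * N) powr (- s) * (V * (2 ^ Suc k * N) ^ ?n))"
      by (rule ennreal_mult'[symmetric]) simp
    also have "(2 ^ k * N) powr (- s) * (V * (2 ^ Suc k * N) ^ ?n) = c * q ^ k"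
    proof -
      have "q ^ k = (2 ^ k) powr (real ?n - s)"
        using powr_powr_swap[of 2 "real ?n - s" "real k"]
        by (simp add: q_def powr_realpow)
      also have "\<dots> = (2 ^ k) ^ ?n * (2 ^ k) powr (- s)"
        using powr_add[of "2 ^ k :: real" "real ?n" "- s"] by (simp add: powr_realpow)
      finally show ?thesis
        using N by (simp add: c_def powr_mult power_mult_distrib mult_ac)
    qed
    finally show ?thesis .
  qed
  have q: "0 \<le> q" "q < 1"
    using s powr_less_mono[of "real ?n - s" 0 "2 :: real"] by (auto simp: q_def)
  have c: "0 \<le> c"
    using V N by (simp add: c_def)
  have sm: "summable (\<lambda>k. c * q ^ k)"
    using q by (intro summable_mult summable_geometric) auto
  have "(\<integral>\<^sup>+ x. ennreal (norm x powr (- s)) * indicator (- ball (0 :: real ^ 'n) N) x \<partial>lborel)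
      \<le> (\<integral>\<^sup>+ x. (\<Sum>k. ?g k x) \<partial>lborel)"
    by (rule nn_integral_mono) (rule le)
  also have "\<dots> = (\<Sum>k. \<integral>\<^sup>+ x. ?g k x \<partial>lborel)"
    by (intro nn_integral_suminf borel_measurable_times_ennreal borel_measurable_const
        borel_measurable_indicator) simp
  also have "\<dots> = (\<Sum>k. ennreal (c * q ^ k))"
    by (simp only: shell)
  also have "\<dots> = ennreal (\<Sum>k. c * q ^ k)"
    using c q by (intro suminf_ennreal2 sm) simp
  also have "\<dots> < \<infinity>" by (simp only: infinity_ennreal_def ennreal_less_top)
  finally show ?thesis .
qed

section \<open>Comparison of norms and integrals over a cube\<close>

lemma AE_p_minus_le:
  fixes p :: "real ^ 'n \<Rightarrow> real"
  shows "AE x in lebesgue. p_minus p \<le> ereal (p x)"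
  using esssup_AE[of "\<lambda>x. - ereal (p x)" lebesgue]
  unfolding p_minus_def by eventually_elim (simp add: ereal_uminus_le_reorder)

text \<open>Here \<open>c\<close> is the portion removed around \<open>y\<close> and
  \<open>t\<close> the other portion; its smallness absorbs the factor \<open>2 * d + 1\<close> into
  \<open>1 / t\<close>.\<close>

lemma norm_ratio_le:
  fixes x y :: "'a :: real_normed_vector"
  assumes "norm (x - y) \<le> d * h" "c * h / 2 \<le> norm y" "0 < h" "0 < c" "c < 1" "0 \<le> d"
    and "0 < t" "t \<le> 1 / (2 * d + 1)"
  shows "norm x / norm y \<le> 1 / (c * t)"
proof -
  have y: "0 < norm y"
    using assms(2-4) by (smt (verit) divide_pos_pos mult_pos_pos)
  have "norm x \<le> norm y + norm (x - y)"
    by (metis add.commute diff_add_cancel norm_triangle_ineq)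
  then have "c * norm x \<le> c * (norm y + d * h)"
    using assms by (intro mult_left_mono) auto
  also have "\<dots> = c * norm y + 2 * d * (c * h / 2)"
    by (simp add: algebra_simps)
  also have "\<dots> \<le> 1 * norm y + 2 * d * norm y"
    using assms y by (intro add_mono mult_right_mono mult_left_mono) auto
  also have "\<dots> = (2 * d + 1) * norm y"
    by (simp add: algebra_simps)
  also have "\<dots> \<le> (1 / t) * norm y"
    using assms by (intro mult_right_mono) (auto simp: field_simps)
  finally show ?thesis
    using y assms by (simp add: field_simps)
qed

text \<open>After enlarging \<open>A\<close> and \<open>B\<close> to \<open>Q\<close>, each of
  \<open>g x\<close> and \<open>g y\<close> leaves one variable free, which contributes a factor
  \<open>emeasure M Q\<close>. The average over the cube later cancels this factor.\<close>

lemma set_nn_integral_le_double: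
  assumes "Q \<in> sets M" and g: "g \<in> borel_measurable M"
    and "A \<subseteq> Q" "B \<subseteq> Q"
    and H: "AE y in M. AE x in M. x \<in> A \<longrightarrow> y \<in> B \<longrightarrow> f x y \<le> g x + g y"
  shows "(\<integral>\<^sup>+ y \<in> B. (\<integral>\<^sup>+ x \<in> A. f x y \<partial>M) \<partial>M) \<le> 2 * emeasure M Q * (\<integral>\<^sup>+ x \<in> Q. g x \<partial>M)"
proof -
  note [measurable] = assms(1) g
  have "(\<integral>\<^sup>+ y \<in> B. (\<integral>\<^sup>+ x \<in> A. f x y \<partial>M) \<partial>M)
      \<le> (\<integral>\<^sup>+ y \<in> Q. (\<integral>\<^sup>+ x \<in> Q. g x + g y \<partial>M) \<partial>M)"
  proof (rule nn_integral_mono_AE)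
    show "AE y in M. (\<integral>\<^sup>+ x \<in> A. f x y \<partial>M) * indicator B y
        \<le> (\<integral>\<^sup>+ x \<in> Q. g x + g y \<partial>M) * indicator Q y"
      using H
    proof eventually_elim
      case (elim y)
      show ?case
      proof (cases "y \<in> B")
        case True
        have "(\<integral>\<^sup>+ x \<in> A. f x y \<partial>M) \<le> (\<integral>\<^sup>+ x \<in> Q. g x + g y \<partial>M)"
        proof (rule nn_integral_mono_AE)
          show "AE x in M. f x y * indicator A x \<le> (g x + g y) * indicator Q x"
            using elim by eventually_elim (use True assms(3) in \<open>auto simp: indicator_def\<close>)
        qed
        then show ?thesis
          using True assms(4) by (auto simp: indicator_def)
      qed simp
    qed
  qed
  also have "\<dots> = (\<integral>\<^sup>+ y \<in> Q. ((\<integral>\<^sup>+ x \<in> Q. g x \<partial>M) + g y * emeasure M Q) \<partial>M)"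
    by (simp add: distrib_right nn_integral_add nn_integral_cmult_indicator)
  also have "\<dots> = (\<integral>\<^sup>+ y. (\<integral>\<^sup>+ x \<in> Q. g x \<partial>M) * indicator Q y + emeasure M Q * (g y * indicator Q y) \<partial>M)"
    by (simp only: distrib_left distrib_right mult_ac)
  also have "\<dots> = (\<integral>\<^sup>+ x \<in> Q. g x \<partial>M) * emeasure M Q + (\<integral>\<^sup>+ y. emeasure M Q * (g y * indicator Q y) \<partial>M)"
    by (simp add: nn_integral_add nn_integral_cmult_indicator)
  also have "\<dots> = 2 * emeasure M Q * (\<integral>\<^sup>+ x \<in> Q. g x \<partial>M)"
    by (subst nn_integral_cmult) (simp_all add: mult_2 distrib_right mult.commute)
  finally show ?thesis .
qed

text \<open>Disjointness makes the indicators add up to that of the union, so the bound is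
  independent of the number of sets.\<close>

lemma sum_set_nn_integral_disjoint_le:
  assumes "finite \<F>" "disjoint \<F>" "\<And>Q. Q \<in> \<F> \<Longrightarrow> Q \<in> sets M" and g: "g \<in> borel_measurable M"
  shows "(\<Sum>Q\<in>\<F>. \<integral>\<^sup>+ x \<in> Q. g x \<partial>M) \<le> (\<integral>\<^sup>+ x. g x \<partial>M)"
proof -
  have "(\<Sum>Q\<in>\<F>. \<integral>\<^sup>+ x \<in> Q. g x \<partial>M) = (\<integral>\<^sup>+ x. (\<Sum>Q\<in>\<F>. g x * indicator Q x) \<partial>M)"
    using assms by (intro nn_integral_sum[symmetric]) auto
  also have "\<dots> \<le> (\<integral>\<^sup>+ x. g x \<partial>M)"
  proof (rule nn_integral_mono)
    fix x
    have "indicator (\<Union>Q\<in>\<F>. Q) x = (\<Sum>Q\<in>\<F>. indicator Q x :: ennreal)"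
      using assms(1,2)
      by (intro indicator_UN_disjoint) (auto simp: disjoint_family_on_def disjoint_def)
    then have "(\<Sum>Q\<in>\<F>. g x * indicator Q x) = g x * indicator (\<Union>\<F>) x"
      by (simp flip: sum_distrib_left)
    then show "(\<Sum>Q\<in>\<F>. g x * indicator Q x) \<le> g x"
      by (simp add: indicator_def)
  qed
  finally show ?thesis .
qed

section \<open>Choice of constants and the uniform bound over families of cubes\<close>

theorem theorem6p4:
  fixes p :: "real ^ 'n \<Rightarrow> real" and N \<alpha> :: real
  assumes p_ge_1: "\<And>x. 1 \<le> p x"
    and p_measurable: "p \<in> borel_measurable lebesgue"
    and p_radial: "radial p"
    and p_bounds: "1 < p_minus p" "p_minus p \<le> p_plus p" "p_plus p < \<infinity>"
    and N: "1 < N"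
    and \<alpha>_pos: "0 < \<alpha>"
    and \<alpha>_less: "\<alpha> < real_of_ereal (p_minus p) * min 1 (real_of_ereal (p_minus p) - 1) / real CARD('n)"
    and decay: "\<And>x y. norm x \<ge> norm y \<Longrightarrow> norm y \<ge> N \<Longrightarrow>
        \<bar>p x - p y\<bar> \<le> \<alpha> * (1 / ln (norm y)) * ln (norm x / norm y)"
  shows "U_infty p"
proof -
  let ?n = "real CARD('n)"
  define P where "P = real_of_ereal (p_minus p)"
  \<comment> \<open>The bounds \<open>1 < p_minus p \<le> p_plus p < \<infinity>\<close> make
    \<open>p_minus p\<close> finite, so \<open>real_of_ereal\<close> does not return a default
    value.\<close>
  have pP: "p_minus p = ereal P"
    using p_bounds by (cases "p_minus p") (auto simp: P_def)
  have P: "1 < P"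
    using p_bounds(1) by (simp add: pP)
  define \<kappa> where "\<kappa> = P * min 1 (P - 1)"
  have "\<alpha> * ?n < \<kappa>"
    using \<alpha>_less by (simp add: \<kappa>_def P_def[symmetric] field_simps)
  then have "1 < \<kappa> / (\<alpha> * ?n)"
    using \<alpha>_pos by simp
  \<comment> \<open>The strict inequality for \<open>\<alpha>\<close> leaves room for some
    \<open>r > 1\<close> that still keeps \<open>s\<close> above the dimension.\<close>
  then obtain r where r: "1 < r" "r < \<kappa> / (\<alpha> * ?n)"
    using dense by blast
  define s where "s = \<kappa> / (\<alpha> * r)"
  have s: "?n < s"
    using r \<alpha>_pos by (simp add: s_def field_simps)
  \<comment> \<open>The ball is open, so points of norm exactly \<open>N\<close>, where
    \<open>decay\<close> already applies, belong to the power tail.\<close>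
  define g :: "real ^ 'n \<Rightarrow> ennreal" where
    "g x = ennreal (norm x powr (- s)) * indicator (- ball 0 N) x + indicator (ball 0 N) x" for x
  have ball_meas: "(indicator (ball 0 N) :: real ^ 'n \<Rightarrow> ennreal) \<in> borel_measurable lborel"
    by (rule borel_measurable_indicator) simp
  have tail_meas: "(\<lambda>x :: real ^ 'n. ennreal (norm x powr (- s)) * indicator (- ball 0 N) x) \<in> borel_measurable lborel"
    by measurable
  have "g \<in> borel_measurable lborel"
    unfolding g_def using tail_meas ball_meas by (rule borel_measurable_add)
  then have g: "g \<in> borel_measurable lebesgue"
    by (rule measurable_completion)
  define K where "K = (\<integral>\<^sup>+ x. g x \<partial>lebesgue)"
  have "K = (\<integral>\<^sup>+ x. g x \<partial>lborel)"
    unfolding K_def by (rule nn_integral_completion)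
  also have "\<dots> = (\<integral>\<^sup>+ x. ennreal (norm x powr (- s)) * indicator (- ball (0 :: real ^ 'n) N) x \<partial>lborel)
      + emeasure lborel (ball (0 :: real ^ 'n) N)"
    unfolding g_def nn_integral_add[OF tail_meas ball_meas] by simp
  also have "\<dots> < \<infinity>"
    using nn_integral_norm_powr_outside_ball[OF s, of N] N
      emeasure_bounded_finite[OF bounded_ball, of "0 :: real ^ 'n" N]
    by simp
  finally have K: "K < \<infinity>" .
  \<comment> \<open>This is the threshold for \<open>t\<close> in \<open>norm_ratio_le\<close> with
    \<open>d = ?n\<close>, the diameter factor of a cube.\<close>
  define \<gamma> where "\<gamma> = 1 / (2 * ?n + 1)"
  have "1 \<le> CARD('n)"
    by (simp add: Suc_leI)
  then have "1 \<le> ?n" by linarith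
  then have "2 < 2 * ?n + 1" by linarith
  then have \<gamma>: "0 < \<gamma>" "\<gamma> < 1 / 2"
    unfolding \<gamma>_def by (simp, intro divide_strict_left_mono) auto
  have ae: "AE x in lebesgue. P \<le> p x"
    using AE_p_minus_le[of p] by (simp add: pP)
  have bound: "(\<Sum>Q\<in>\<F>. (1 / emeasure lebesgue Q) *
      (INF (E, G) \<in> subsets_of_portion Q lam \<times> subsets_of_portion Q tau.
        \<integral>\<^sup>+ y \<in> Q - G. (\<integral>\<^sup>+ x \<in> Q - E. ennreal (F_fun p lam tau x y powr (1 / r)) \<partial>lebesgue)
          \<partial>lebesgue)) \<le> 2 * K"
    if lt: "0 < lam" "lam < \<gamma>" "0 < tau" "tau < \<gamma>"
      and \<F>: "finite \<F>" "\<And>Q. Q \<in> \<F> \<Longrightarrow> cube Q" "disjoint \<F>" for lam tau \<F>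
  proof -
    have lt1: "lam < 1" "tau < 1"
      using lt \<gamma> by auto
    have "(1 / emeasure lebesgue Q) *
      (INF (E, G) \<in> subsets_of_portion Q lam \<times> subsets_of_portion Q tau.
        \<integral>\<^sup>+ y \<in> Q - G. (\<integral>\<^sup>+ x \<in> Q - E. ennreal (F_fun p lam tau x y powr (1 / r)) \<partial>lebesgue)
          \<partial>lebesgue) \<le> 2 * (\<integral>\<^sup>+ x \<in> Q. g x \<partial>lebesgue)"
      (is "_ * ?inf \<le> _") if QF: "Q \<in> \<F>" for Q
    proof -
      obtain h where h: "0 < h" and Q: "Q \<in> lmeasurable" "measure lebesgue Q = h ^ CARD('n)"
        and diam: "\<forall>x\<in>Q. \<forall>y\<in>Q. norm (x - y) \<le> ?n * h"
        and portion: "\<forall>c\<in>{0<..<1}. \<exists>E\<in>subsets_of_portion Q c. \<forall>x\<in>Q - E. c * h / 2 \<le> norm x"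
        by (rule cube_portion_near_origin[OF \<F>(2)[OF QF]])
      obtain E where E: "E \<in> subsets_of_portion Q lam" "\<And>x. x \<in> Q - E \<Longrightarrow> lam * h / 2 \<le> norm x"
        using bspec[OF portion, of lam] lt lt1 by auto
      obtain G where G: "G \<in> subsets_of_portion Q tau" "\<And>x. x \<in> Q - G \<Longrightarrow> tau * h / 2 \<le> norm x"
        using bspec[OF portion, of tau] lt lt1 by auto
      have pointwise: "ennreal (F_fun p lam tau x y powr (1 / r)) \<le> g x + g y"
        if px: "P \<le> p x" and py: "P \<le> p y" and xy: "x \<in> Q - E" "y \<in> Q - G" for x y
      \<comment> \<open>If one point lies in the ball, \<open>g\<close> equals 1 there and the
        trivial bound \<open>F_fun \<le> 1\<close> suffices.\<close>
      proof (cases "N \<le> norm x \<and> N \<le> norm y")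
        case False
        have "F_fun p lam tau x y powr (1 / r) \<le> 1"
          using F_fun_le_1[of P p x y lam tau] P px py F_fun_nonneg[of p lam tau x y] lt lt1 r
          by (intro powr_le1) auto
        then have "ennreal (F_fun p lam tau x y powr (1 / r)) \<le> 1"
          by (simp add: ennreal_le_1)
        also have "1 \<le> g x + g y"
        proof -
          have "g x = 1 \<or> g y = 1"
            using False by (auto simp: g_def)
          then show ?thesis
            by (metis add.commute le_iff_add)
        qed
        finally show ?thesis .
      next
        case True
        have gx: "g x = ennreal (norm x powr (- s))" and gy: "g y = ennreal (norm y powr (- s))"
          using True by (auto simp: g_def)
        show ?thesis
        proof (cases "norm y \<le> norm x")
          case le: True
          \<comment> \<open>The smaller norm is that of \<open>y\<close>, which avoids
            \<open>G\<close>, so \<open>c = tau\<close> and \<open>t = lam\<close>. In the opposite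
            case \<open>x\<close> avoids \<open>E\<close> and the two parameters swap.\<close>
          have "norm x / norm y \<le> 1 / (tau * lam)"
            using norm_ratio_le[of x y ?n h tau lam] diam G(2) xy h lt lt1 by (simp add: \<gamma>_def)
          then have "F_fun p lam tau x y powr (1 / r) \<le> norm y powr (- s)"
            unfolding s_def \<kappa>_def using decay[OF le] True N le r
            by (intro F_fun_powr_le[where M = "norm x" and p = p]) (use P px py lt lt1 \<alpha>_pos in auto)
          then show ?thesis
            unfolding gx gy by (intro add_increasing ennreal_leI) auto
        next
          case False
          then have le: "norm x \<le> norm y" by simp
          have "norm y / norm x \<le> 1 / (lam * tau)"
            using norm_ratio_le[of y x ?n h lam tau] diam E(2) xy h lt lt1 by (simp add: \<gamma>_def)
          then have "F_fun p lam tau x y powr (1 / r) \<le> norm x powr (- s)"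
            unfolding s_def \<kappa>_def using decay[OF le] True N le r
            by (intro F_fun_powr_le[where M = "norm y" and p = p])
              (use P px py lt lt1 \<alpha>_pos in \<open>auto simp: mult.commute\<close>)
          then show ?thesis
            unfolding gx gy by (intro add_increasing2 ennreal_leI) auto
        qed
      qed
      \<comment> \<open>The measure must be positive and finite for its quotient to cancel in
        \<open>ennreal\<close>.\<close>
      have "emeasure lebesgue Q = ennreal (h ^ CARD('n))"
        using emeasure_eq_ennreal_measure[OF fmeasurableD2[OF Q(1)]] Q(2) by simp
      then have eQ: "emeasure lebesgue Q \<noteq> 0" "emeasure lebesgue Q < top"
        using h by simp_all
      have "?inf \<le> (\<integral>\<^sup>+ y \<in> Q - G. (\<integral>\<^sup>+ x \<in> Q - E.
          ennreal (F_fun p lam tau x y powr (1 / r)) \<partial>lebesgue) \<partial>lebesgue)"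
        using E(1) G(1) by (intro INF_lower2[of "(E, G)"]) auto
      also have "\<dots> \<le> 2 * emeasure lebesgue Q * (\<integral>\<^sup>+ x \<in> Q. g x \<partial>lebesgue)"
      proof (rule set_nn_integral_le_double)
        \<comment> \<open>The lower bound \<open>P \<le> p x\<close> comes from an essential infimum
          and holds only almost everywhere, in each variable separately.\<close>
        show "AE y in lebesgue. AE x in lebesgue. x \<in> Q - E \<longrightarrow> y \<in> Q - G \<longrightarrow>
            ennreal (F_fun p lam tau x y powr (1 / r)) \<le> g x + g y"
          using ae
        proof eventually_elim
          case y: (elim y)
          show ?case
            using ae by eventually_elim (use y pointwise in blast)
        qed
      qed (use Q g in auto)
      finally have "1 / emeasure lebesgue Q * ?inf
          \<le> 1 / emeasure lebesgue Q * (2 * emeasure lebesgue Q * (\<integral>\<^sup>+ x \<in> Q. g x \<partial>lebesgue))"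
        by (rule mult_left_mono) simp
      also have "\<dots> = (1 / emeasure lebesgue Q * emeasure lebesgue Q) * (2 * (\<integral>\<^sup>+ x \<in> Q. g x \<partial>lebesgue))"
        by (simp only: mult_ac)
      also have "1 / emeasure lebesgue Q * emeasure lebesgue Q = 1"
        using eQ by (simp add: ennreal_divide_times)
      finally show ?thesis by simp
    qed
    then have "(\<Sum>Q\<in>\<F>. (1 / emeasure lebesgue Q) *
      (INF (E, G) \<in> subsets_of_portion Q lam \<times> subsets_of_portion Q tau.
        \<integral>\<^sup>+ y \<in> Q - G. (\<integral>\<^sup>+ x \<in> Q - E. ennreal (F_fun p lam tau x y powr (1 / r)) \<partial>lebesgue)
          \<partial>lebesgue)) \<le> (\<Sum>Q\<in>\<F>. 2 * (\<integral>\<^sup>+ x \<in> Q. g x \<partial>lebesgue))"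
      by (rule sum_mono)
    also have "\<dots> = 2 * (\<Sum>Q\<in>\<F>. \<integral>\<^sup>+ x \<in> Q. g x \<partial>lebesgue)"
      by (simp add: sum_distrib_left)
    also have "\<dots> \<le> 2 * K"
    proof -
      have "Q \<in> sets lebesgue" if "Q \<in> \<F>" for Q
        by (rule cube_portion_near_origin[OF \<F>(2)[OF that]]) (rule fmeasurableD)
      then show ?thesis
        unfolding K_def using \<F> g by (intro mult_left_mono sum_set_nn_integral_disjoint_le) auto
    qed
    finally show ?thesis .
  qed
  \<comment> \<open>The summand 1 makes \<open>C\<close> positive without a lower bound on
    \<open>K\<close>.\<close>
  define C where "C = 2 * enn2real K + 1"
  have "2 * K = ennreal (2 * enn2real K)"
    using K by (simp add: ennreal_mult)
  also have "\<dots> \<le> ennreal C"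
    by (intro ennreal_leI) (simp add: C_def)
  finally have C: "2 * K \<le> ennreal C" .
  have "0 < C"
    using enn2real_nonneg[of K] unfolding C_def by linarith
  show ?thesis
    unfolding U_infty_def
  proof (rule exI[of _ C], rule exI[of _ r], rule exI[of _ \<gamma>], intro conjI allI impI, goal_cases)
    case (5 lam tau \<F>)
    then show ?case
      using order_trans[OF bound[of lam tau \<F>] C] by blast
  qed (fact \<open>0 < C\<close> r \<gamma>)+
qed

end
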